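(* Let $H$ be a graph with vertex set $\{1,\dots,p\}$ and let $G$ be a graph of order $n$. Let $\mu_1,\dots,\mu_s,\mu_{s+1},\dots,\mu_t$ (with $t\le n$) be the distinct eigenvalues of $G$, where $\mu_1,\dots,\mu_s$ are exactly the main eigenvalues of $G$, and let $m_j$ be the multiplicity of $\mu_j$, $1\le j\le t$. Then, as multisets (union with possible repetitions), $$\sigma(H[G])=\{\mu_1^{[p(m_1-1)]},\dots,\mu_s^{[p(m_s-1)]}\}\cup\{\mu_{s+1}^{[pm_{s+1}]},\dots,\mu_t^{[pm_t]}\}\cup\sigma(\widetilde{\mathbf W}),$$ where $\widetilde{\mathbf W}$ is the $H[G]$ associated matrix defined below.
   Context: All graphs are finite, simple and undirected; $\sigma(\cdot)$ denotes the multiset of eigenvalues of the adjacency matrix (or of a square matrix), and $\mu^{[m]}$ means multiplicity $m$. An eigenvalue $\mu$ of a graph $G$ of order $n$ is main if its eigenspace is not orthogonal to the all-ones vector $\mathbf j_n$, and non-main otherwise. The lexicographic product $H[G]$ has vertex set $V(H)\times V(G)$, with $(h_1,g_1)\sim(h_2,g_2)$ iff $h_1h_2\in E(H)$, or $h_1=h_2$ and $g_1g_2\in E(G)$. Let $\delta_{i,j}=1$ if $ij\in E(H)$ and $0$ otherwise. If $\mu_1,\dots,\mu_s$ are the distinct main eigenvalues of $G$, the main characteristic polynomial is $m_G(x)=\prod_{i=1}^s(x-\mu_i)=x^s-c_0-c_1x-\dots-c_{s-1}x^{s-1}$. The walk matrix of $G$ is the $n\times s$ matrix $\mathbf W_G=(\mathbf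 j_n, A(G)\mathbf j_n,\dots,A(G)^{s-1}\mathbf j_n)$. Let $\mathbf C(m_G)$ be the $s\times s$ Frobenius companion matrix whose last column is $(c_0,c_1,\dots,c_{s-1})^T$, whose entries in positions $(i+1,i)$, $1\le i\le s-1$, equal $1$, and all other entries $0$. Let $\mathbf M$ be the $s\times s$ matrix whose first row is $\mathbf j_n^T\mathbf W_G$ and all other rows are zero. The $H[G]$ associated matrix is the $ps\times ps$ block matrix $\widetilde{\mathbf W}$ whose $(i,i)$ diagonal blocks are $\mathbf C(m_G)$ and whose $(i,j)$ off-diagonal blocks ($i\neq j$) are $\delta_{i,j}\mathbf M$, $1\le i,j\le p$. *)

theory Defs
  imports
    "Graph_Theory.Pair_Digraph"
    "Jordan_Normal_Form.Char_Poly"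
    "HOL-Computational_Algebra.Polynomial"
    "HOL-Library.Countable_Set"
    Complex_Main
begin

text \<open>
  A finite simple undirected graph is a \<^locale>\<open>pair_graph\<close>: a finite vertex set with a
  symmetric, irreflexive set of arcs, the edge \<open>uv\<close> being the pair of arcs \<open>(u, v)\<close>, \<open>(v, u)\<close>.
\<close>

definition lex_product ::
  "'a pair_pre_digraph \<Rightarrow> 'b pair_pre_digraph \<Rightarrow> ('a \<times> 'b) pair_pre_digraph" where
  "lex_product H G =
    \<lparr> pverts = pverts H \<times> pverts G,
      parcs = {((h1, g1), (h2, g2)) | h1 g1 h2 g2.
        h1 \<in> pverts H \<and> h2 \<in> pverts H \<and> g1 \<in> pverts G \<and> g2 \<in> pverts G \<and>
        ((h1, h2) \<in> parcs H \<or> h1 = h2 \<and> (g1, g2) \<in> parcs G)} \<rparr>"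

text \<open>
  Rows and columns are numbered through the library enumeration \<^const>\<open>from_nat_into\<close>, which is a
  bijection from \<open>{..<card V}\<close> to a finite \<open>V\<close>; another numbering gives a
  permutation-similar matrix. The entries are taken in \<open>\<complex>\<close> so that \<open>eigval_mset\<close> below sees every
  eigenvalue, also for matrices that are not symmetric.
\<close>

definition adjacency_mat :: "'a pair_pre_digraph \<Rightarrow> complex mat" where
  "adjacency_mat G = mat (card (pverts G)) (card (pverts G))
    (\<lambda>(i, j). if (from_nat_into (pverts G) i, from_nat_into (pverts G) j) \<in> parcs G
              then 1 else 0)"

text \<open>The multiset of eigenvalues, each with its algebraic multiplicity.\<close>

definition eigval_mset :: "complex mat \<Rightarrow> complex multiset" where
  "eigval_mset A = proots (char_poly A)"

definition all_ones :: "nat \<Rightarrow> complex vec" where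
  "all_ones n = vec n (\<lambda>_. 1)"

definition main_eigenvalue :: "'a pair_pre_digraph \<Rightarrow> complex \<Rightarrow> bool" where
  "main_eigenvalue G \<mu> \<longleftrightarrow>
    (\<exists>x. eigenvector (adjacency_mat G) x \<mu> \<and> x \<bullet> all_ones (card (pverts G)) \<noteq> 0)"

definition num_main :: "'a pair_pre_digraph \<Rightarrow> nat" where
  "num_main G = card {\<mu>. main_eigenvalue G \<mu>}"

definition main_char_poly :: "'a pair_pre_digraph \<Rightarrow> complex poly" where
  "main_char_poly G = (\<Prod>\<mu> | main_eigenvalue G \<mu>. [:- \<mu>, 1:])"

text \<open>The \<open>k\<close>-th column (counted from \<open>0\<close>) is \<open>A\<^sup>k j\<close>.\<close>

definition walk_mat :: "'a pair_pre_digraph \<Rightarrow> complex mat" where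
  "walk_mat G = mat (card (pverts G)) (num_main G)
    (\<lambda>(i, k). (adjacency_mat G ^\<^sub>m k *\<^sub>v all_ones (card (pverts G))) $ i)"

text \<open>
  Companion matrix of a monic \<open>q = x\<^sup>s - c\<^sub>0 - c\<^sub>1 x - \<dots>\<close>; hence the last column
  \<open>c\<^sub>i = - coeff q i\<close>.
\<close>

definition frobenius_companion :: "complex poly \<Rightarrow> complex mat" where
  "frobenius_companion q = mat (degree q) (degree q)
    (\<lambda>(i, j). if j = degree q - 1 then - coeff q i
              else if i = j + 1 then 1 else 0)"

definition first_row_mat :: "'a pair_pre_digraph \<Rightarrow> complex mat" where
  "first_row_mat G = mat (num_main G) (num_main G)
    (\<lambda>(i, j). if i = 0
              then (transpose_mat (walk_mat G) *\<^sub>v all_ones (card (pverts G))) $ j else 0)"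

text \<open>
  Meant for \<open>pverts H = {1..p}\<close>. Matrix indices start at \<open>0\<close>, so that with \<open>s = num_main G\<close> the
  index \<open>a\<close> lies in block \<open>a div s + 1\<close>, at offset \<open>a mod s\<close>.
\<close>

definition associated_mat ::
  "nat \<Rightarrow> nat pair_pre_digraph \<Rightarrow> 'a pair_pre_digraph \<Rightarrow> complex mat" where
  "associated_mat p H G = (let s = num_main G in mat (p * s) (p * s)
    (\<lambda>(a, b).
      let i = a div s + 1; j = b div s + 1; k = a mod s; l = b mod s in
      if i = j then frobenius_companion (main_char_poly G) $$ (k, l)
      else (if (i, j) \<in> parcs H then 1 else 0) * first_row_mat G $$ (k, l)))"

end

theory Submission
  imports Defs
begin

text \<open>
  Write \<open>j\<close> for the all-ones vector of \<open>G\<close>, \<open>A\<close> for its adjacency matrix, \<open>K\<close> for that of \<open>H\<close>,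
  \<open>C\<close> for the companion matrix and \<open>W\<close> for the walk matrix. The adjacency matrix of \<open>H[G]\<close> is
  \<open>I \<otimes> A + K \<otimes> j j\<^sup>T\<close> and the associated matrix is \<open>I \<otimes> C + K \<otimes> e\<^sub>1 (j\<^sup>T W)\<close>. For generic \<open>x\<close>
  the determinant identity \<open>det (I - X Y) = det (I - Y X)\<close> turns their characteristic polynomials into
  \<open>det (x I - A)\<^sup>p det (I - a K)\<close> and \<open>det (x I - C)\<^sup>p det (I - b K)\<close> with
  \<open>a = j\<^sup>T (x I - A)\<^sup>-\<^sup>1 j\<close> and \<open>b = j\<^sup>T W (x I - C)\<^sup>-\<^sup>1 e\<^sub>1\<close>. As \<open>m\<^sub>G(A) j = 0\<close>, we have \<open>A W = W C\<close>,
  whence \<open>a = b\<close>. Since \<open>C\<close> has characteristic polynomial \<open>m\<^sub>G\<close>, the two characteristic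
  polynomials differ by the factor \<open>(det (x I - A) / m\<^sub>G)\<^sup>p\<close>.
\<close>

section \<open>Determinants of block matrices\<close>

text \<open>Sylvester's identity: multiplying \<open>?F\<close> by \<open>?L\<close> on either side
  clears one off-diagonal block, leaving a block triangular matrix whose determinant is one of the
  two sides. Determinants of products do not depend on the order.\<close>

lemma det_one_minus_mult_commute:
  fixes X Y :: "'a :: idom mat"
  assumes X: "X \<in> carrier_mat n m" and Y: "Y \<in> carrier_mat m n"
  shows "det (1\<^sub>m n - X * Y) = det (1\<^sub>m m - Y * X)"
proof -
  let ?F = "four_block_mat (1\<^sub>m n) X Y (1\<^sub>m m)"
  let ?L = "four_block_mat (1\<^sub>m n) (0\<^sub>m n m) (- Y) (1\<^sub>m m)"
  have F: "?F \<in> carrier_mat (n + m) (n + m)" and L: "?L \<in> carrier_mat (n + m) (n + m)"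
    using X Y by auto
  have detL: "det ?L = 1"
    using Y by (subst det_four_block_mat_upper_right_zero[of _ n _ m]) auto
  have FL: "?F * ?L = four_block_mat (1\<^sub>m n - X * Y) X (0\<^sub>m m n) (1\<^sub>m m)"
    using X Y
    by (subst mult_four_block_mat[of _ n n _ m _ m _ _ n _ m])
      (auto simp: add_uminus_minus_mat[of _ n n]
        intro!: cong_four_block_mat)
  have LF: "?L * ?F = four_block_mat (1\<^sub>m n) X (0\<^sub>m m n) (1\<^sub>m m - Y * X)"
    using X Y
    by (subst mult_four_block_mat[of _ n n _ m _ m _ _ n _ m])
      (auto simp: uminus_add_minus_mat[of _ m m] intro!: cong_four_block_mat)
  have "det (1\<^sub>m n - X * Y) = det (?F * ?L)"
    unfolding FL using X Y by (subst det_four_block_mat_lower_left_zero[of _ n _ m]) auto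
  also have "\<dots> = det (?L * ?F)"
    using det_mult[OF F L] det_mult[OF L F] by simp
  also have "\<dots> = det (1\<^sub>m m - Y * X)"
    unfolding LF using X Y by (subst det_four_block_mat_lower_left_zero[of _ n _ m]) auto
  finally show ?thesis .
qed

text \<open>Blocks are a function of two block numbers, and an index splits by \<open>div\<close>
  and \<open>mod\<close> exactly as in \<open>associated_mat\<close>, so both matrices of the proof
  can be matched entry by entry.\<close>

definition block_mat :: "nat \<Rightarrow> nat \<Rightarrow> (nat \<Rightarrow> nat \<Rightarrow> 'a mat) \<Rightarrow> 'a mat" where
  "block_mat p n F = mat (p * n) (p * n) (\<lambda>(a, b). F (a div n) (b div n) $$ (a mod n, b mod n))"

lemma block_mat_carrier [simp]: "block_mat p n F \<in> carrier_mat (p * n) (p * n)"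
  by (simp add: block_mat_def)

lemma div_mod_less_mult:
  fixes a :: nat
  assumes "a < p * n"
  shows "a div n < p" "a mod n < n"
  using assms by (cases "n = 0"; simp add: less_mult_imp_div_less)+

lemma sum_block_index:
  fixes f :: "nat \<Rightarrow> 'a :: comm_monoid_add"
  shows "(\<Sum>c<p * n. f c) = (\<Sum>i<p. \<Sum>k<n. f (i * n + k))"
proof -
  have "(\<Sum>c<p * n. f c) = (\<Sum>i<p. sum f {i * n..<i * n + n})"
    by (simp add: sum.nat_group)
  also have "\<dots> = (\<Sum>i<p. \<Sum>k<n. f (i * n + k))"
  proof (rule sum.cong[OF refl])
    fix i
    show "sum f {i * n..<i * n + n} = (\<Sum>k<n. f (i * n + k))"
      using sum.shift_bounds_nat_ivl[of f 0 "i * n" n]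
      by (simp add: lessThan_atLeast0 add.commute)
  qed
  finally show ?thesis .
qed

text \<open>Induction splits off the first diagonal block; the remaining indices drop by
  \<open>n\<close>, which lowers the block number by one and keeps the offset.\<close>

lemma det_block_diag:
  fixes B :: "'a :: idom mat"
  assumes B: "B \<in> carrier_mat n n"
  shows "det (block_mat p n (\<lambda>i j. if i = j then B else 0\<^sub>m n n)) = det B ^ p"
proof (induction p)
  case 0
  then show ?case by (simp add: block_mat_def)
next
  case (Suc p)
  let ?D = "\<lambda>p. block_mat p n (\<lambda>i j. if i = j then B else 0\<^sub>m n n)"
  have "?D (Suc p) = four_block_mat B (0\<^sub>m n (p * n)) (0\<^sub>m (p * n) n) (?D p)"
  proof (rule eq_matI, goal_cases)
    case (1 a b)
    then have "n > 0" using B by (auto intro: gr0I simp: block_mat_def)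
    with 1 B show ?case
      by (auto simp: block_mat_def div_mod_less_mult le_div_geq le_mod_geq not_less
          dest: div_mod_less_mult)
  qed (use B in \<open>auto simp: block_mat_def\<close>)
  then show ?case
    using B Suc by (simp add: det_four_block_mat_lower_left_zero[of _ n _ "p * n"])
qed

text \<open>The matrix is \<open>I \<otimes> B - K \<otimes> u v\<^sup>T\<close>. With \<open>u = B w\<close> it factors as
  \<open>(I \<otimes> B) (I - X Y)\<close> where \<open>X\<close> and \<open>Y\<close> have only \<open>p\<close> columns and rows.\<close>

lemma det_block_rank_one:
  fixes B K :: "'a :: idom mat"
  assumes B: "B \<in> carrier_mat n n" and K: "K \<in> carrier_mat p p"
    and w: "w \<in> carrier_vec n" and v: "v \<in> carrier_vec n"
  shows "det (block_mat p n (\<lambda>i j. mat n n (\<lambda>(k, l).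
      (if i = j then B $$ (k, l) else 0) - K $$ (i, j) * (B *\<^sub>v w) $ k * v $ l)))
    = det B ^ p * det (1\<^sub>m p - (v \<bullet> w) \<cdot>\<^sub>m K)"
    (is "det ?M = _")
proof -
  let ?D = "block_mat p n (\<lambda>i j. if i = j then B else 0\<^sub>m n n)"
  \<comment> \<open>In Kronecker terms X is K \<otimes> w and Y is I \<otimes> v^T. Hence
    \<open>?D * X * Y\<close> is K \<otimes> (B w) v^T, while \<open>Y * X\<close> is only the
    scalar v . w times \<open>K\<close>.\<close>
  define X where "X = mat (p * n) p (\<lambda>(a, j). K $$ (a div n, j) * w $ (a mod n))"
  define Y where "Y = mat p (p * n) (\<lambda>(i, b). if i = b div n then v $ (b mod n) else 0)"
  have X: "X \<in> carrier_mat (p * n) p" and Y: "Y \<in> carrier_mat p (p * n)"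
    by (simp_all add: X_def Y_def)
  have D: "?D \<in> carrier_mat (p * n) (p * n)" by simp
  have DX: "?D * X = mat (p * n) p (\<lambda>(a, j). K $$ (a div n, j) * (B *\<^sub>v w) $ (a mod n))"
  proof (rule eq_matI, goal_cases)
    case (1 a j)
    then have a: "a < p * n" "a div n < p" "a mod n < n" and j: "j < p"
      by (auto dest: div_mod_less_mult)
    have "(?D * X) $$ (a, j) = (\<Sum>c<p * n. ?D $$ (a, c) * X $$ (c, j))"
      using a j X by (simp add: scalar_prod_def lessThan_atLeast0 block_mat_def)
    also have "\<dots> = (\<Sum>i<p. \<Sum>l<n. ?D $$ (a, i * n + l) * X $$ (i * n + l, j))"
      by (rule sum_block_index)
    also have "\<dots> = (\<Sum>i<p. \<Sum>l<n. if i = a div n then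
        K $$ (a div n, j) * (B $$ (a mod n, l) * w $ l) else 0)"
    proof (intro sum.cong refl, goal_cases)
      case (1 i l)
      then have "i * n + l < p * n"
        by (simp add: mult_less_mono1 less_le_trans[OF _ mult_le_mono1[of "Suc i" p n]])
      with 1 a j show ?case by (auto simp: block_mat_def X_def)
    qed
    also have "\<dots> = (\<Sum>l<n. K $$ (a div n, j) * (B $$ (a mod n, l) * w $ l))"
      using a by (subst sum.swap) simp
    also have "\<dots> = K $$ (a div n, j) * (B *\<^sub>v w) $ (a mod n)"
      using a B w by (simp add: scalar_prod_def lessThan_atLeast0 sum_distrib_left)
    finally show ?case using a j by simp
  qed (use X in \<open>auto simp: block_mat_def\<close>)
  have "?M = ?D - ?D * X * Y"
    unfolding DX
  proof (rule eq_matI, goal_cases)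
    case (1 a b)
    then have ab: "a < p * n" "a div n < p" "a mod n < n" "b < p * n" "b div n < p" "b mod n < n"
      using Y by (auto dest: div_mod_less_mult)
    then show ?case using B
      by (auto simp: block_mat_def Y_def scalar_prod_def if_distrib cong: if_cong)
  qed (use Y in \<open>auto simp: block_mat_def\<close>)
  also have "\<dots> = ?D * (1\<^sub>m (p * n) - X * Y)"
    using mult_minus_distrib_mat[OF D one_carrier_mat mult_carrier_mat[OF X Y]]
    by (simp add: assoc_mult_mat[OF D X Y] right_mult_one_mat[OF D])
  also have "det \<dots> = det B ^ p * det (1\<^sub>m (p * n) - X * Y)"
    using X Y by (subst det_mult[of _ "p * n"]) (auto simp: det_block_diag[OF B])
  also have "det (1\<^sub>m (p * n) - X * Y) = det (1\<^sub>m p - Y * X)"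
    by (rule det_one_minus_mult_commute[OF X Y])
  also have "Y * X = (v \<bullet> w) \<cdot>\<^sub>m K"
  proof (rule eq_matI, goal_cases)
    case (1 i j)
    then have i: "i < p" and j: "j < p" using K by auto
    have "(Y * X) $$ (i, j) = (\<Sum>c<p * n. Y $$ (i, c) * X $$ (c, j))"
      using i j X Y by (simp add: scalar_prod_def lessThan_atLeast0)
    also have "\<dots> = (\<Sum>i'<p. \<Sum>l<n. Y $$ (i, i' * n + l) * X $$ (i' * n + l, j))"
      by (rule sum_block_index)
    also have "\<dots> = (\<Sum>i'<p. \<Sum>l<n. if i' = i then K $$ (i, j) * (v $ l * w $ l) else 0)"
    proof (intro sum.cong refl, goal_cases)
      case (1 i' l)
      then have "i' * n + l < p * n"
        by (simp add: mult_less_mono1 less_le_trans[OF _ mult_le_mono1[of "Suc i'" p n]])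
      with 1 i j show ?case by (auto simp: X_def Y_def)
    qed
    also have "\<dots> = (\<Sum>l<n. K $$ (i, j) * (v $ l * w $ l))"
      using i by (subst sum.swap) simp
    also have "\<dots> = (v \<bullet> w) * K $$ (i, j)"
      using w v by (simp add: scalar_prod_def lessThan_atLeast0 sum_distrib_left mult.commute)
    finally show ?case using i j K by simp
  qed (use X Y K in auto)
  finally show ?thesis .
qed

text \<open>Rows and columns are permuted alike, so the sign of the permutation enters twice and
  cancels. This bridges the library numbering of the vertices of H[G] and the block
  numbering.\<close>

lemma det_reindex:
  assumes A: "A \<in> carrier_mat n n" and f: "bij_betw f {..<n} {..<n}"
  shows "det (mat n n (\<lambda>(i, j). A $$ (f i, f j))) = det A"
proof -
  \<comment> \<open>\<open>permutes\<close> asks for a total function that fixes everything outside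
    the index range.\<close>
  define q where "q i = (if i < n then f i else i)" for i
  have q: "q permutes {0..<n}"
    using f bij_betw_cong[of "{..<n}" q f "{..<n}"]
    by (intro bij_imp_permutes) (auto simp: q_def lessThan_atLeast0)
  have f_less: "f i < n" if "i < n" for i using f that by (auto dest: bij_betwE)
  let ?R = "mat n n (\<lambda>(i, j). A $$ (q i, j))"
  have "mat n n (\<lambda>(i, j). A $$ (f i, f j)) = transpose_mat (mat n n (\<lambda>(i, j). transpose_mat ?R $$ (q i, j)))"
    using A by (intro eq_matI) (auto simp: q_def f_less)
  also have "det \<dots> = det (mat n n (\<lambda>(i, j). transpose_mat ?R $$ (q i, j)))"
    by (rule det_transpose) auto
  also have "\<dots> = signof q * det (transpose_mat ?R)"
    by (rule det_permute_rows[OF _ q]) auto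
  also have "det (transpose_mat ?R) = det ?R"
    by (rule det_transpose) auto
  also have "det ?R = signof q * det A"
    by (rule det_permute_rows[OF A q])
  also have "signof q * (signof q * det A) = det A"
    by (cases q rule: sign_cases) auto
  finally show ?thesis .
qed

section \<open>Polynomials in a matrix applied to a vector\<close>

text \<open>This is the vector q(A) v, built from the vectors
  \<open>A ^\<^sub>m k *\<^sub>v v\<close> that also form the walk matrix.\<close>

definition poly_apply :: "'a :: comm_ring_1 mat \<Rightarrow> 'a poly \<Rightarrow> 'a vec \<Rightarrow> 'a vec" where
  "poly_apply A q v =
    vec (dim_row A) (\<lambda>i. \<Sum>k\<le>degree q. coeff q k * (A ^\<^sub>m k *\<^sub>v v) $ i)"

lemma poly_apply_carrier [simp]: "A \<in> carrier_mat n n \<Longrightarrow> poly_apply A q v \<in> carrier_vec n"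
  by (auto simp: poly_apply_def)

text \<open>A free bound \<open>N\<close> lets polynomials of different degrees be summed over one
  common range.\<close>

lemma poly_apply_index:
  assumes "A \<in> carrier_mat n n" "i < n" "degree q \<le> N"
  shows "poly_apply A q v $ i = (\<Sum>k\<le>N. coeff q k * (A ^\<^sub>m k *\<^sub>v v) $ i)"
proof -
  have "(\<Sum>k\<le>degree q. coeff q k * (A ^\<^sub>m k *\<^sub>v v) $ i) = (\<Sum>k\<le>N. coeff q k * (A ^\<^sub>m k *\<^sub>v v) $ i)"
    using assms(3) by (intro sum.mono_neutral_left) (auto simp: coeff_eq_0)
  then show ?thesis using assms by (auto simp: poly_apply_def)
qed

text \<open>Matrix powers unfold with the new factor on the right; the induction, with
  \<open>v\<close> arbitrary, moves it to the left.\<close>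

lemma pow_mat_mult_vec_Suc:
  fixes A :: "'a :: comm_ring_1 mat"
  assumes A: "A \<in> carrier_mat n n" and v: "v \<in> carrier_vec n"
  shows "A ^\<^sub>m Suc k *\<^sub>v v = A *\<^sub>v (A ^\<^sub>m k *\<^sub>v v)"
  using v
proof (induction k arbitrary: v)
  case 0
  then show ?case using A by simp
next
  case (Suc k)
  have Av: "A *\<^sub>v v \<in> carrier_vec n" using A Suc.prems by simp
  have "A ^\<^sub>m Suc (Suc k) *\<^sub>v v = A ^\<^sub>m Suc k *\<^sub>v (A *\<^sub>v v)"
    using assoc_mult_mat_vec[OF pow_carrier_mat[OF A] A Suc.prems, of "Suc k"] by simp
  also have "\<dots> = A *\<^sub>v (A ^\<^sub>m k *\<^sub>v (A *\<^sub>v v))" by (rule Suc.IH[OF Av])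
  also have "A ^\<^sub>m k *\<^sub>v (A *\<^sub>v v) = A ^\<^sub>m Suc k *\<^sub>v v"
    using assoc_mult_mat_vec[OF pow_carrier_mat[OF A] A Suc.prems, of k] by simp
  finally show ?case .
qed

lemma poly_apply_0: "A \<in> carrier_mat n n \<Longrightarrow> poly_apply A 0 v = 0\<^sub>v n"
  by (auto simp: poly_apply_def)

text \<open>Horner's rule, the recursion behind the later inductions over polynomials.\<close>

lemma poly_apply_pCons:
  fixes A :: "'a :: comm_ring_1 mat"
  assumes A: "A \<in> carrier_mat n n" and v: "v \<in> carrier_vec n"
  shows "poly_apply A (pCons a q) v = a \<cdot>\<^sub>v v + A *\<^sub>v poly_apply A q v"
proof (rule eq_vecI, goal_cases)
  case (1 i)
  then have i: "i < n" using A by simp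
  have "poly_apply A (pCons a q) v $ i
      = (\<Sum>k\<le>Suc (degree q). coeff (pCons a q) k * (A ^\<^sub>m k *\<^sub>v v) $ i)"
    using A i by (intro poly_apply_index) (auto simp: degree_pCons_le)
  also have "\<dots> = a * v $ i + (\<Sum>k\<le>degree q. coeff q k * (A *\<^sub>v (A ^\<^sub>m k *\<^sub>v v)) $ i)"
    using A v by (subst sum.atMost_Suc_shift) (simp add: pow_mat_mult_vec_Suc[OF A v] del: pow_mat.simps(2))
  also have "(\<Sum>k\<le>degree q. coeff q k * (A *\<^sub>v (A ^\<^sub>m k *\<^sub>v v)) $ i)
      = (\<Sum>k\<le>degree q. \<Sum>l<n. A $$ (i, l) * (coeff q k * (A ^\<^sub>m k *\<^sub>v v) $ l))"
    using A i by (simp add: scalar_prod_def sum_distrib_left lessThan_atLeast0 mult.left_commute)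
  also have "\<dots> = (\<Sum>l<n. A $$ (i, l) * poly_apply A q v $ l)"
    using A by (subst sum.swap) (simp add: poly_apply_index[OF A _ order.refl] sum_distrib_left)
  also have "\<dots> = (A *\<^sub>v poly_apply A q v) $ i"
    using A i by (simp add: scalar_prod_def lessThan_atLeast0 carrier_vecD[OF poly_apply_carrier[OF A]])
  finally show ?case using A v i by simp
qed (use A v in \<open>auto simp: poly_apply_def\<close>)

lemma poly_apply_add:
  assumes A: "A \<in> carrier_mat n n"
  shows "poly_apply A (p + q) v = poly_apply A p v + poly_apply A q v"
proof (rule eq_vecI, goal_cases)
  case (1 i)
  then have i: "i < n" using carrier_vecD[OF poly_apply_carrier[OF A]] by simp
  let ?N = "max (degree p) (degree q)"
  show ?case
    using poly_apply_index[OF A i degree_add_le_max, of p q v]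
      poly_apply_index[OF A i, of p ?N v] poly_apply_index[OF A i, of q ?N v]
      i carrier_vecD[OF poly_apply_carrier[OF A]]
    by (simp add: sum.distrib algebra_simps)
qed (use carrier_vecD[OF poly_apply_carrier[OF A]] in simp)

lemma poly_apply_smult:
  assumes A: "A \<in> carrier_mat n n"
  shows "poly_apply A (Polynomial.smult c q) v = c \<cdot>\<^sub>v poly_apply A q v"
proof (rule eq_vecI, goal_cases)
  case (1 i)
  then have i: "i < n" using carrier_vecD[OF poly_apply_carrier[OF A]] by simp
  show ?case
    using poly_apply_index[OF A i degree_smult_le, of c q v] poly_apply_index[OF A i, of q "degree q" v]
      i carrier_vecD[OF poly_apply_carrier[OF A]]
    by (simp add: sum_distrib_left mult.assoc)
qed (use carrier_vecD[OF poly_apply_carrier[OF A]] in simp)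

text \<open>The polynomials that annihilate \<open>v\<close> form an ideal.\<close>

lemma poly_apply_mult_eq_0:
  assumes A: "A \<in> carrier_mat n n" and v: "v \<in> carrier_vec n" and q: "poly_apply A q v = 0\<^sub>v n"
  shows "poly_apply A (r * q) v = 0\<^sub>v n"
proof (induction r)
  case 0
  then show ?case using A by (simp add: poly_apply_0)
next
  case (pCons a r)
  then have "poly_apply A (pCons a r * q) v = a \<cdot>\<^sub>v 0\<^sub>v n + (0 \<cdot>\<^sub>v v + A *\<^sub>v 0\<^sub>v n)"
    using q by (simp add: poly_apply_add[OF A] poly_apply_smult[OF A] poly_apply_pCons[OF A v])
  also have "\<dots> = 0\<^sub>v n" using A v by (intro eq_vecI) auto
  finally show ?case .
qed

text \<open>The hypothesis reads (A - x I) q(A) v = 0. The vector q(A) v may still be zero here;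
  minimality of the degree excludes this later.\<close>

lemma poly_apply_linear_factor:
  assumes A: "A \<in> carrier_mat n n" and v: "v \<in> carrier_vec n"
    and 0: "poly_apply A ([:- x, 1:] * q) v = 0\<^sub>v n"
  shows "A *\<^sub>v poly_apply A q v = x \<cdot>\<^sub>v poly_apply A q v"
proof -
  let ?u = "poly_apply A q v"
  have u: "?u \<in> carrier_vec n" using A by auto
  have "[:- x, 1:] * q = Polynomial.smult (- x) q + pCons 0 q" by simp
  with 0 have "(- x) \<cdot>\<^sub>v ?u + (0 \<cdot>\<^sub>v v + A *\<^sub>v ?u) = 0\<^sub>v n"
    by (simp only: poly_apply_add[OF A] poly_apply_smult[OF A] poly_apply_pCons[OF A v])
  then have eq: "((- x) \<cdot>\<^sub>v ?u + (0 \<cdot>\<^sub>v v + A *\<^sub>v ?u)) $ i = 0\<^sub>v n $ i" for i by simp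
  show ?thesis
  proof (rule eq_vecI, goal_cases)
    case (1 i)
    then have "i < n" using u by simp
    with eq[of i] u A v show ?case by (simp add: carrier_vecD[OF u])
  qed (use A in \<open>auto simp: poly_apply_def\<close>)
qed

text \<open>Symmetry moves every factor \<open>A\<close> over to \<open>y\<close>, where it acts as
  multiplication by \<open>x\<close>.\<close>

lemma eigenvector_scalar_prod_poly_apply:
  assumes A: "A \<in> carrier_mat n n" and sym: "transpose_mat A = A"
    and v: "v \<in> carrier_vec n" and y: "y \<in> carrier_vec n" and ev: "A *\<^sub>v y = x \<cdot>\<^sub>v y"
  shows "y \<bullet> poly_apply A q v = poly q x * (y \<bullet> v)"
proof (induction q)
  case 0
  then show ?case using A y by (simp add: poly_apply_0)
next
  case (pCons a q)
  let ?u = "poly_apply A q v"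
  have u: "?u \<in> carrier_vec n" using A by simp
  have "y \<bullet> (A *\<^sub>v ?u) = (A *\<^sub>v y) \<bullet> ?u"
    using transpose_vec_mult_scalar[OF A u y] sym by simp
  also have "\<dots> = x * (poly q x * (y \<bullet> v))"
    using ev y u pCons by simp
  finally show ?case
    using A v y u by (simp add: poly_apply_pCons[OF A v] scalar_prod_add_distrib[of _ n] algebra_simps)
qed

text \<open>The vectors \<open>v, A v, \<dots>, A\<^sup>n v\<close>, extended by a zero row, form a singular square matrix.\<close>

lemma annihilating_poly_exists:
  fixes A :: "'a :: field mat"
  assumes A: "A \<in> carrier_mat n n"
  obtains q where "q \<noteq> 0" "poly_apply A q v = 0\<^sub>v n"
proof -
  define K where "K = mat (Suc n) (Suc n) (\<lambda>(i, k). if i < n then (A ^\<^sub>m k *\<^sub>v v) $ i else 0)"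
  have K: "K \<in> carrier_mat (Suc n) (Suc n)" by (simp add: K_def)
  have "transpose_mat K *\<^sub>v unit_vec (Suc n) n = 0\<^sub>v (Suc n)"
    by (rule eq_vecI) (auto simp: K_def)
  then have "det (transpose_mat K) = 0"
    using K by (subst det_0_iff_vec_prod_zero[of _ "Suc n"])
      (auto intro!: exI[of _ "unit_vec (Suc n) n"] simp: unit_vec_nonzero)
  then have "det K = 0" using det_transpose[OF K] by simp
  then obtain c where c: "c \<in> carrier_vec (Suc n)" "c \<noteq> 0\<^sub>v (Suc n)" "K *\<^sub>v c = 0\<^sub>v (Suc n)"
    using det_0_iff_vec_prod_zero[OF K] by auto
  \<comment> \<open>A kernel vector of \<open>K\<close> is a linear relation between the vectors,
    read as a list of coefficients.\<close>
  define q where "q = (\<Sum>k\<le>n. monom (c $ k) k)"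
  have coeff_q: "coeff q k = (if k \<le> n then c $ k else 0)" for k
    by (auto simp: q_def coeff_sum)
  have "degree q \<le> n" by (rule degree_le) (simp add: coeff_q)
  have "q \<noteq> 0"
  proof
    assume "q = 0"
    then have "c $ k = 0" if "k \<le> n" for k using coeff_q[of k] that by simp
    then have "c = 0\<^sub>v (Suc n)" using c(1) by (intro eq_vecI) auto
    with c(2) show False by simp
  qed
  moreover have "poly_apply A q v = 0\<^sub>v n"
  proof (rule eq_vecI, goal_cases)
    case (1 i)
    then have i: "i < n" by simp
    have "poly_apply A q v $ i = (\<Sum>k\<le>n. (A ^\<^sub>m k *\<^sub>v v) $ i * c $ k)"
      using poly_apply_index[OF A i \<open>degree q \<le> n\<close>, of v] by (simp add: coeff_q mult.commute)
    also have "\<dots> = (K *\<^sub>v c) $ i"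
      using i c(1) by (simp add: K_def scalar_prod_def atLeast0LessThan lessThan_Suc_atMost)
    finally show ?case using c(3) i by simp
  qed (use A in \<open>auto simp: poly_apply_def\<close>)
  ultimately show ?thesis by (rule that)
qed

text \<open>An annihilator \<open>q\<close> of \<open>v\<close> of least degree works: for a root \<open>x\<close> of \<open>q = (X - x) r\<close> the
  vector \<open>u = r(A) v\<close> is an eigenvector, and \<open>u\<^sup>* u = r(x) (u\<^sup>* v)\<close> is nonzero. Hence \<open>x\<close> is
  a simple root, and its eigenspace is not orthogonal to \<open>v\<close>.\<close>

lemma main_poly_annihilates:
  fixes A :: "complex mat"
  assumes A: "A \<in> carrier_mat n n" and sym: "transpose_mat A = A" and real: "map_mat cnj A = A"
    and v: "v \<in> carrier_vec n"
    and M: "finite M" "\<And>x y. eigenvector A y x \<Longrightarrow> y \<bullet> v \<noteq> 0 \<Longrightarrow> x \<in> M"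
  shows "poly_apply A (\<Prod>x\<in>M. [:- x, 1:]) v = 0\<^sub>v n"
proof -
  let ?P = "\<lambda>q. q \<noteq> 0 \<and> poly_apply A q v = 0\<^sub>v n"
  obtain q0 where "?P q0" using annihilating_poly_exists[OF A] by metis
  define q where "q = arg_min degree ?P"
  have q: "?P q" unfolding q_def using \<open>?P q0\<close> by (rule arg_min_natI)
  have q_min: "degree q \<le> degree r" if "?P r" for r
    unfolding q_def using that by (rule arg_min_nat_le)
  have root: "x \<in> M \<and> order x q = 1" if x: "poly q x = 0" for x
  proof -
    obtain r where r: "q = [:- x, 1:] * r" using x by (auto simp: poly_eq_0_iff_dvd)
    define u where "u = poly_apply A r v"
    \<comment> \<open>The product \<bullet> is bilinear, without conjugation; conjugating one
      argument makes \<open>y \<bullet> u\<close> the squared norm of \<open>u\<close>.\<close>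
    define y where "y = conjugate u"
    have u: "u \<in> carrier_vec n" and y: "y \<in> carrier_vec n" using A by (auto simp: u_def y_def)
    have "r \<noteq> 0" using q r by auto
    moreover have "degree r < degree q" using \<open>r \<noteq> 0\<close> unfolding r by (subst degree_mult_eq) auto
    ultimately have "u \<noteq> 0\<^sub>v n" using q_min[of r] by (auto simp: u_def)
    have Au: "A *\<^sub>v u = x \<cdot>\<^sub>v u"
      using poly_apply_linear_factor[OF A v, of x r] q r by (simp add: u_def)
    have yu: "y \<bullet> u \<noteq> 0"
      using \<open>u \<noteq> 0\<^sub>v n\<close> conjugate_square_eq_0_vec[OF u] comm_scalar_prod[OF u y]
      by (metis y_def)
    have Ay: "A *\<^sub>v y = cnj x \<cdot>\<^sub>v y"
    proof -
      have "A *\<^sub>v y = map_mat cnj A *\<^sub>v conjugate u" by (simp add: real y_def)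
      also have "\<dots> = conjugate (A *\<^sub>v u)" using A u
        by (intro eq_vecI) (auto simp: scalar_prod_def)
      also have "\<dots> = cnj x \<cdot>\<^sub>v y" by (simp add: Au y_def conjugate_smult_vec)
      finally show ?thesis .
    qed
    \<comment> \<open>The usual argument that a real symmetric matrix has real eigenvalues; it makes
      \<open>y\<close> an eigenvector for \<open>x\<close> itself, as the preceding lemma on scalar
      products requires.\<close>
    have "x * (y \<bullet> u) = y \<bullet> (A *\<^sub>v u)" using u y by (simp add: Au)
    also have "\<dots> = (A *\<^sub>v y) \<bullet> u" using transpose_vec_mult_scalar[OF A u y] sym by simp
    also have "\<dots> = cnj x * (y \<bullet> u)" using u y by (simp add: Ay)
    finally have "cnj x = x" using yu by simp
    with Ay have Ay': "A *\<^sub>v y = x \<cdot>\<^sub>v y" by simp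
    have "y \<bullet> u = poly r x * (y \<bullet> v)"
      unfolding u_def by (rule eigenvector_scalar_prod_poly_apply[OF A sym v y Ay'])
    with yu have "poly r x \<noteq> 0" and yv: "y \<bullet> v \<noteq> 0" by auto
    have "y \<noteq> 0\<^sub>v n" using yv v by auto
    then have "eigenvector A y x" using A y Ay' by (simp add: eigenvector_def)
    then have "x \<in> M" using M(2) yv by blast
    moreover have "order x q = 1"
    proof -
      have "order x q = order x [:- x, 1:] + order x r"
        using q unfolding r by (intro order_mult) auto
      also have "order x r = 0" using \<open>poly r x \<noteq> 0\<close> by (rule order_0I)
      finally show ?thesis by (simp add: order_linear')
    qed
    ultimately show ?thesis by simp
  qed
  \<comment> \<open>With simple roots that all lie in \<open>M\<close>, \<open>q\<close> is a
    constant times a subproduct of the linear factors over \<open>M\<close>, so it divides their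
    product.\<close>
  have "rsquarefree q"
    using q root by (auto simp: rsquarefree_def order_root)
  then have "q = Polynomial.smult (lead_coeff q) (\<Prod>x | poly q x = 0. [:- x, 1:])"
    by (simp add: complex_poly_decompose_rsquarefree)
  moreover have "(\<Prod>x | poly q x = 0. [:- x, 1:]) dvd (\<Prod>x\<in>M. [:- x, 1:])"
    using root M(1) by (intro prod_dvd_prod_subset) auto
  ultimately have "q dvd (\<Prod>x\<in>M. [:- x, 1:])"
    using q by (metis smult_dvd leading_coeff_0_iff)
  then obtain r where "(\<Prod>x\<in>M. [:- x, 1:]) = r * q" by (auto simp: dvd_def mult.commute)
  then show ?thesis using poly_apply_mult_eq_0[OF A v, of q r] q by simp
qed

section \<open>Companion and walk matrices\<close>

lemma prod_linear_factors_monic: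
  fixes M :: "'a :: idom set"
  assumes "finite M"
  shows "degree (\<Prod>x\<in>M. [:- x, 1:]) = card M" "coeff (\<Prod>x\<in>M. [:- x, 1:]) (card M) = 1"
proof -
  show "degree (\<Prod>x\<in>M. [:- x, 1:]) = card M"
    using assms by (subst degree_prod_eq_sum_degree) auto
  then show "coeff (\<Prod>x\<in>M. [:- x, 1:]) (card M) = 1"
    using lead_coeff_prod[of "\<lambda>x. [:- x, 1:]" M] by simp
qed

text \<open>\<open>(1, x, \<dots>, x\<^sup>s\<^sup>-\<^sup>1)\<close> is a left eigenvector of the companion matrix at every root \<open>x\<close>, and
  there are as many distinct roots as the degree.\<close>

lemma char_poly_frobenius_companion:
  assumes "finite M"
  shows "char_poly (frobenius_companion (\<Prod>x\<in>M. [:- x, 1:])) = (\<Prod>x\<in>M. [:- x, 1:])"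
proof -
  define q :: "complex poly" where "q = (\<Prod>x\<in>M. [:- x, 1:])"
  define s where "s = card M"
  let ?C = "frobenius_companion q"
  have deg: "degree q = s" and monic: "coeff q s = 1"
    using prod_linear_factors_monic[OF assms] by (simp_all add: q_def s_def)
  have C: "?C \<in> carrier_mat s s" by (simp add: frobenius_companion_def deg)
  have root: "poly (char_poly ?C) x = 0" if x: "x \<in> M" for x
  proof -
    define z where "z = vec s (\<lambda>i. x ^ i)"
    have "s > 0" using x assms by (auto simp: s_def card_gt_0_iff)
    have "poly q x = 0" using x assms by (auto simp: q_def poly_prod)
    then have "(\<Sum>i<s. coeff q i * x ^ i) + x ^ s = 0"
      by (simp add: poly_altdef deg monic lessThan_Suc_atMost[symmetric])
    then have pow: "(\<Sum>i<s. - coeff q i * x ^ i) = x ^ s"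
      by (simp add: sum_negf neg_eq_iff_add_eq_0)
    have "transpose_mat ?C *\<^sub>v z = x \<cdot>\<^sub>v z"
    proof (rule eq_vecI, goal_cases)
      case (1 j)
      then have j: "j < s" by (simp add: z_def)
      have "(transpose_mat ?C *\<^sub>v z) $ j = (\<Sum>i<s. ?C $$ (i, j) * x ^ i)"
        using j C by (simp add: scalar_prod_def z_def lessThan_atLeast0)
      also have "\<dots> = x ^ Suc j"
      proof (cases "j = s - 1")
        case True
        then have "(\<Sum>i<s. ?C $$ (i, j) * x ^ i) = (\<Sum>i<s. - coeff q i * x ^ i)"
          using j by (intro sum.cong) (auto simp: frobenius_companion_def deg)
        with pow True \<open>s > 0\<close> show ?thesis by simp
      next
        case False
        then have "(\<Sum>i<s. ?C $$ (i, j) * x ^ i) = (\<Sum>i<s. if i = Suc j then x ^ i else 0)"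
          using j by (intro sum.cong) (auto simp: frobenius_companion_def deg)
        with False j show ?thesis by simp
      qed
      finally show ?case using j by (simp add: z_def)
    qed (use C in \<open>auto simp: z_def\<close>)
    moreover have "z \<noteq> 0\<^sub>v s"
    proof
      assume "z = 0\<^sub>v s"
      then have "z $ 0 = 0" using \<open>s > 0\<close> by simp
      then show False using \<open>s > 0\<close> by (simp add: z_def)
    qed
    ultimately have "eigenvalue (transpose_mat ?C) x"
      using C by (auto simp: eigenvalue_def eigenvector_def z_def intro!: exI[of _ z])
    then show ?thesis
      using eigenvalue_root_char_poly[of "transpose_mat ?C" s x] C by simp
  qed
  \<comment> \<open>Two monic polynomials of degree \<open>s\<close> differ by one of smaller
    degree; vanishing at the \<open>s\<close> points of \<open>M\<close> forces the difference to be
    zero.\<close>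
  define d where "d = char_poly ?C - q"
  have "d = 0"
  proof (rule ccontr)
    assume "d \<noteq> 0"
    have "coeff d i = 0" if "i \<ge> s" for i
      using that degree_monic_char_poly[OF C] deg monic
      by (cases "i = s") (auto simp: d_def coeff_eq_0)
    then have "degree d < s" using \<open>d \<noteq> 0\<close> by (meson leading_coeff_0_iff not_le)
    moreover have "card M \<le> card {x. poly d x = 0}"
    proof (rule card_mono)
      show "finite {x. poly d x = 0}" using \<open>d \<noteq> 0\<close> by (rule poly_roots_finite)
      show "M \<subseteq> {x. poly d x = 0}"
        using root assms by (auto simp: d_def q_def poly_prod)
    qed
    moreover have "card {x. poly d x = 0} \<le> degree d" using \<open>d \<noteq> 0\<close> by (rule card_poly_roots_bound)
    ultimately show False by (simp add: s_def)
  qed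
  then show ?thesis by (simp add: d_def q_def)
qed

section \<open>Adjacency matrices, main eigenvalues and the walk matrix\<close>

lemma adjacency_mat_carrier [simp]:
  "adjacency_mat G \<in> carrier_mat (card (pverts G)) (card (pverts G))"
  by (simp add: adjacency_mat_def)

lemma transpose_adjacency_mat:
  assumes "pair_graph G"
  shows "transpose_mat (adjacency_mat G) = adjacency_mat G"
proof -
  interpret pair_graph G by fact
  have "(u, v) \<in> parcs G \<longleftrightarrow> (v, u) \<in> parcs G" for u v
    by (auto intro: arcs_symmetric)
  then show ?thesis by (intro eq_matI) (auto simp: adjacency_mat_def)
qed

lemma map_mat_cnj_adjacency_mat: "map_mat cnj (adjacency_mat G) = adjacency_mat G"
  by (intro eq_matI) (auto simp: adjacency_mat_def)

lemma all_ones_carrier [simp]: "all_ones n \<in> carrier_vec n"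
  by (simp add: all_ones_def)

lemma finite_main_eigenvalues: "finite {x. main_eigenvalue G x}"
proof -
  let ?A = "adjacency_mat G"
  have "char_poly ?A \<noteq> 0"
    using degree_monic_char_poly[OF adjacency_mat_carrier, of G] by auto
  then have "finite {x. poly (char_poly ?A) x = 0}" by (rule poly_roots_finite)
  moreover have "{x. main_eigenvalue G x} \<subseteq> {x. poly (char_poly ?A) x = 0}"
    using eigenvalue_root_char_poly[OF adjacency_mat_carrier, of G]
    by (auto simp: main_eigenvalue_def eigenvalue_def)
  ultimately show ?thesis by (rule finite_subset[rotated])
qed

lemma degree_main_char_poly: "degree (main_char_poly G) = num_main G"
  and coeff_main_char_poly: "coeff (main_char_poly G) (num_main G) = 1"
  using prod_linear_factors_monic[OF finite_main_eigenvalues, of G]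
  by (simp_all add: main_char_poly_def num_main_def)

lemma frobenius_companion_carrier [simp]:
  "frobenius_companion (main_char_poly G) \<in> carrier_mat (num_main G) (num_main G)"
  by (simp add: frobenius_companion_def degree_main_char_poly)

lemma walk_mat_carrier [simp]: "walk_mat G \<in> carrier_mat (card (pverts G)) (num_main G)"
  by (simp add: walk_mat_def)

lemma main_char_poly_annihilates:
  assumes "pair_graph G"
  shows "poly_apply (adjacency_mat G) (main_char_poly G) (all_ones (card (pverts G)))
    = 0\<^sub>v (card (pverts G))"
  unfolding main_char_poly_def
  by (rule main_poly_annihilates[OF adjacency_mat_carrier transpose_adjacency_mat[OF assms]
        map_mat_cnj_adjacency_mat all_ones_carrier finite_main_eigenvalues])
    (auto simp: main_eigenvalue_def)

text \<open>Multiplication by the adjacency matrix shifts each walk column to the next. The last one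
  leaves the matrix and returns as a combination of all columns, because the main characteristic
  polynomial annihilates the all-ones vector.\<close>

lemma adjacency_mult_walk_mat:
  assumes "pair_graph G"
  shows "adjacency_mat G * walk_mat G = walk_mat G * frobenius_companion (main_char_poly G)"
proof (rule eq_matI, goal_cases)
  case (1 i k)
  define n where "n = card (pverts G)"
  define s where "s = num_main G"
  define A where "A = adjacency_mat G"
  define j where "j = all_ones n"
  define q where "q = main_char_poly G"
  define C where "C = frobenius_companion q"
  define W where "W = walk_mat G"
  have A: "A \<in> carrier_mat n n" and j: "j \<in> carrier_vec n" by (simp_all add: A_def n_def j_def)
  have W: "W \<in> carrier_mat n s" and C: "C \<in> carrier_mat s s"
    by (simp_all add: W_def C_def q_def n_def s_def)
  have ik: "i < n" "k < s"
    using 1 by (simp_all add: walk_mat_def n_def s_def frobenius_companion_def degree_main_char_poly)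
  have W_index: "W $$ (l, k') = (A ^\<^sub>m k' *\<^sub>v j) $ l" if "l < n" "k' < s" for l k'
    using that by (simp add: W_def walk_mat_def A_def j_def n_def s_def)
  have "(A * W) $$ (i, k) = (\<Sum>l<n. A $$ (i, l) * (A ^\<^sub>m k *\<^sub>v j) $ l)"
    using ik A W by (simp add: scalar_prod_def lessThan_atLeast0 W_index)
  also have "\<dots> = (A *\<^sub>v (A ^\<^sub>m k *\<^sub>v j)) $ i"
    using ik A by (simp add: scalar_prod_def lessThan_atLeast0)
  also have "\<dots> = (A ^\<^sub>m Suc k *\<^sub>v j) $ i"
    by (simp only: pow_mat_mult_vec_Suc[OF A j])
  finally have lhs: "(A * W) $$ (i, k) = (A ^\<^sub>m Suc k *\<^sub>v j) $ i" .
  have "(W * C) $$ (i, k) = (\<Sum>l<s. (A ^\<^sub>m l *\<^sub>v j) $ i * C $$ (l, k))"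
    using ik C W by (simp add: scalar_prod_def lessThan_atLeast0 W_index)
  also have "\<dots> = (A ^\<^sub>m Suc k *\<^sub>v j) $ i"
  proof (cases "k = s - 1")
    case True
    have "0 = (\<Sum>l\<le>s. coeff q l * (A ^\<^sub>m l *\<^sub>v j) $ i)"
      using poly_apply_index[OF A ik(1), of q s j] main_char_poly_annihilates[OF assms] ik
      by (simp add: A_def j_def n_def q_def s_def degree_main_char_poly)
    also have "\<dots> = (\<Sum>l<s. coeff q l * (A ^\<^sub>m l *\<^sub>v j) $ i) + (A ^\<^sub>m s *\<^sub>v j) $ i"
      by (simp add: lessThan_Suc_atMost[symmetric] q_def s_def coeff_main_char_poly)
    finally have "(A ^\<^sub>m s *\<^sub>v j) $ i = - (\<Sum>l<s. coeff q l * (A ^\<^sub>m l *\<^sub>v j) $ i)"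
      by (simp add: eq_neg_iff_add_eq_0 add.commute)
    also have "\<dots> = (\<Sum>l<s. (A ^\<^sub>m l *\<^sub>v j) $ i * C $$ (l, k))"
      unfolding sum_negf[symmetric] using True ik
      by (intro sum.cong)
        (auto simp: C_def q_def s_def frobenius_companion_def degree_main_char_poly)
    finally show ?thesis using True ik by simp
  next
    case False
    have "(\<Sum>l<s. (A ^\<^sub>m l *\<^sub>v j) $ i * C $$ (l, k))
        = (\<Sum>l<s. if l = Suc k then (A ^\<^sub>m Suc k *\<^sub>v j) $ i else 0)"
      using False ik
      by (intro sum.cong)
        (auto simp: C_def q_def s_def frobenius_companion_def degree_main_char_poly)
    with False ik show ?thesis by simp
  qed
  finally show ?case using lhs by (simp add: A_def W_def C_def q_def)
qed (simp_all add: walk_mat_def adjacency_mat_def frobenius_companion_def degree_main_char_poly)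

text \<open>Without main eigenvalues the empty product 1 would annihilate the all-ones vector, which
  is nonzero on a nonempty vertex set.\<close>

lemma num_main_pos:
  assumes "pair_graph G" "pverts G \<noteq> {}"
  shows "num_main G > 0"
proof (rule ccontr)
  interpret pair_graph G by fact
  define n where "n = card (pverts G)"
  have "n > 0" using assms(2) by (simp add: n_def card_gt_0_iff)
  assume "\<not> num_main G > 0"
  then have "main_char_poly G = 1"
    using finite_main_eigenvalues[of G] by (simp add: num_main_def main_char_poly_def)
  then have "poly_apply (adjacency_mat G) 1 (all_ones n) $ 0 = 0"
    using main_char_poly_annihilates[OF assms(1)] \<open>n > 0\<close> by (simp add: n_def)
  moreover have "poly_apply (adjacency_mat G) 1 (all_ones n) $ 0 = 1"
    using \<open>n > 0\<close> poly_apply_index[OF adjacency_mat_carrier, of 0 G 1 0 "all_ones n"]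
    by (simp add: n_def all_ones_def adjacency_mat_def)
  ultimately show False by simp
qed

text \<open>The first walk column is the all-ones vector. It exists as soon as there is a vertex, by
  \<open>num_main_pos\<close>.\<close>

lemma walk_mat_unit_vec:
  assumes "pair_graph G"
  shows "walk_mat G *\<^sub>v unit_vec (num_main G) 0 = all_ones (card (pverts G))"
proof (rule eq_vecI, goal_cases)
  case (1 i)
  then have "i < card (pverts G)" by (simp add: all_ones_def)
  then have "pverts G \<noteq> {}" by auto
  then have "num_main G > 0" by (rule num_main_pos[OF assms])
  then show ?case using \<open>i < card (pverts G)\<close>
    by (simp add: walk_mat_def all_ones_def adjacency_mat_def)
qed (simp add: walk_mat_def all_ones_def)

section \<open>Characteristic polynomial of the lexicographic product\<close>

lemma pair_graph_loopfree: "pair_graph H \<Longrightarrow> (i, i) \<notin> parcs H"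
proof -
  assume "pair_graph H"
  then interpret pair_graph H .
  show ?thesis by (auto dest: no_loops')
qed

lemma finite_pair_graph_verts: "pair_graph G \<Longrightarrow> finite (pverts G)"
proof -
  assume "pair_graph G"
  then interpret pair_graph G .
  show ?thesis by simp
qed

text \<open>Since \<open>- char_matrix C x\<close> is x I - C, \<open>w\<close> plays the role of (x
  I - C)^-1 e_1 and v . w is the scalar b of the overview. The off-diagonal blocks are rank one, e_1
  v^T, as \<open>det_block_rank_one\<close> requires.\<close>

lemma poly_char_poly_associated_mat:
  fixes x :: complex and G :: "'a pair_pre_digraph"
  assumes H: "pair_graph H"
  defines "s \<equiv> num_main G" and "C \<equiv> frobenius_companion (main_char_poly G)"
  assumes w: "w \<in> carrier_vec s" and Cw: "- char_matrix C x *\<^sub>v w = unit_vec s 0"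
  defines "v \<equiv> transpose_mat (walk_mat G) *\<^sub>v all_ones (card (pverts G))"
  shows "poly (char_poly (associated_mat p H G)) x = poly (char_poly C) x ^ p *
    det (1\<^sub>m p - (v \<bullet> w) \<cdot>\<^sub>m mat p p (\<lambda>(i, j). if (i + 1, j + 1) \<in> parcs H then 1 else 0))"
proof -
  define K :: "complex mat" where "K = mat p p (\<lambda>(i, j). if (i + 1, j + 1) \<in> parcs H then 1 else 0)"
  define B where "B = - char_matrix C x"
  let ?T = "associated_mat p H G"
  have C: "C \<in> carrier_mat s s" by (simp add: C_def s_def)
  then have B: "B \<in> carrier_mat s s" by (simp add: B_def)
  have K: "K \<in> carrier_mat p p" by (simp add: K_def)
  have v: "v \<in> carrier_vec s" 
    unfolding v_def s_def by (rule mult_mat_vec_carrier[of _ _ "card (pverts G)"]) auto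
  have T: "?T \<in> carrier_mat (p * s) (p * s)"
    by (simp add: associated_mat_def s_def Let_def)
  have "- char_matrix ?T x = block_mat p s (\<lambda>i j. mat s s (\<lambda>(k, l).
      (if i = j then B $$ (k, l) else 0) - K $$ (i, j) * (B *\<^sub>v w) $ k * v $ l))"
  proof (rule eq_matI, goal_cases)
    case (1 a b)
    then have ab: "a < p * s" "b < p * s" by (simp_all add: block_mat_def)
    note less = div_mod_less_mult[OF ab(1)] div_mod_less_mult[OF ab(2)]
    have eq: "a = b \<longleftrightarrow> a div s = b div s \<and> a mod s = b mod s" by (metis div_mult_mod_eq)
    have "(- char_matrix ?T x) $$ (a, b) = (if a = b then x else 0) - ?T $$ (a, b)"
      using ab T by (simp add: char_matrix_def)
    also have "?T $$ (a, b) = (if a div s = b div s then C $$ (a mod s, b mod s)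
        else K $$ (a div s, b div s) * (unit_vec s 0 $ (a mod s) * v $ (b mod s)))"
      using ab less by (auto simp: associated_mat_def Let_def s_def[symmetric] C_def K_def
          first_row_mat_def v_def)
    \<comment> \<open>The rank-one term may be subtracted in diagonal blocks too: \<open>H\<close>
      has no loops, so \<open>K\<close> has zero diagonal.\<close>
    also have "(if a = b then x else 0) - \<dots> = (if a div s = b div s then B $$ (a mod s, b mod s) else 0)
        - K $$ (a div s, b div s) * (unit_vec s 0 $ (a mod s) * v $ (b mod s))"
      using less C by (auto simp: eq B_def char_matrix_def K_def pair_graph_loopfree[OF H])
    finally show ?case
      using ab less by (simp add: block_mat_def Cw[folded B_def] mult.assoc)
  qed (use T in \<open>auto simp: block_mat_def char_matrix_def\<close>)
  then have "poly (char_poly ?T) x = det B ^ p * det (1\<^sub>m p - (v \<bullet> w) \<cdot>\<^sub>m K)"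
    using det_block_rank_one[OF B K w v] by (simp add: char_poly_matrix[OF T])
  then show ?thesis by (simp add: B_def char_poly_matrix[OF C] K_def)
qed

text \<open>The same scheme with \<open>w\<close> as (x I - A)^-1 j; here both vectors of the
  rank-one blocks are all-ones.\<close>

lemma poly_char_poly_lex_product:
  fixes x :: complex and G :: "'a pair_pre_digraph"
  assumes H: "pair_graph H" and VH: "pverts H = {1..p}" and G: "pair_graph G"
  defines "n \<equiv> card (pverts G)"
  assumes w: "w \<in> carrier_vec n" and Aw: "- char_matrix (adjacency_mat G) x *\<^sub>v w = all_ones n"
  shows "poly (char_poly (adjacency_mat (lex_product H G))) x = poly (char_poly (adjacency_mat G)) x ^ p *
    det (1\<^sub>m p - (all_ones n \<bullet> w) \<cdot>\<^sub>m mat p p (\<lambda>(i, j). if (i + 1, j + 1) \<in> parcs H then 1 else 0))"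
proof -
  define K :: "complex mat" where "K = mat p p (\<lambda>(i, j). if (i + 1, j + 1) \<in> parcs H then 1 else 0)"
  define A where "A = adjacency_mat G"
  define B where "B = - char_matrix A x"
  define V where "V = pverts (lex_product H G)"
  define L where "L = adjacency_mat (lex_product H G)"
  define e where "e = from_nat_into V"
  define eG where "eG = from_nat_into (pverts G)"
  \<comment> \<open>\<open>g\<close> numbers the vertices copy by copy of \<open>G\<close>, with the
    vertices of \<open>H\<close> starting at 1; \<open>f\<close> sends a block index to the index of
    the same vertex in the library enumeration.\<close>
  define g where "g a = (a div n + 1, eG (a mod n))" for a
  define f where "f = inv_into {..<p * n} e \<circ> g"
  have V: "V = {1..p} \<times> pverts G" by (simp add: V_def lex_product_def VH)
  have finG: "finite (pverts G)" by (rule finite_pair_graph_verts[OF G])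
  have cardV: "card V = p * n" and finV: "finite V"
    using finG by (simp_all add: V card_cartesian_product n_def)
  have e: "bij_betw e {..<p * n} V"
    using bij_betw_from_nat_into_finite[OF finV] by (simp add: e_def cardV)
  have eG: "bij_betw eG {..<n} (pverts G)"
    using bij_betw_from_nat_into_finite[OF finG] by (simp add: eG_def n_def)
  have "inj_on g {..<p * n}"
  proof (rule inj_onI)
    fix a b assume ab: "a \<in> {..<p * n}" "b \<in> {..<p * n}" "g a = g b"
    then have "a mod n = b mod n"
      using bij_betw_imp_inj_on[OF eG] div_mod_less_mult[of a p n] div_mod_less_mult[of b p n]
      by (auto simp: g_def inj_on_def)
    moreover have "a div n = b div n" using ab by (simp add: g_def)
    ultimately show "a = b" by (metis div_mult_mod_eq)
  qed
  moreover have "g ` {..<p * n} \<subseteq> V"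
    using bij_betwE[OF eG] div_mod_less_mult[of _ p n] by (force simp: g_def V Suc_le_eq)
  ultimately have g: "bij_betw g {..<p * n} V"
    using finV cardV unfolding bij_betw_def by (metis card_image card_lessThan card_subset_eq)
  have f: "bij_betw f {..<p * n} {..<p * n}"
    unfolding f_def by (rule bij_betw_trans[OF g bij_betw_inv_into[OF e]])
  have ef: "e (f a) = g a" if "a < p * n" for a
    using that bij_betwE[OF g] bij_betw_inv_into_right[OF e] by (auto simp: f_def)
  have f_less: "f a < p * n" if "a < p * n" for a
    using bij_betwE[OF f] that by auto
  have f_eq: "f a = f b \<longleftrightarrow> a = b" if "a < p * n" "b < p * n" for a b
    using bij_betw_imp_inj_on[OF f] that by (auto simp: inj_on_def)
  have A: "A \<in> carrier_mat n n" by (simp add: A_def n_def)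
  then have B: "B \<in> carrier_mat n n" by (simp add: B_def)
  have K: "K \<in> carrier_mat p p" by (simp add: K_def)
  have Bw: "B *\<^sub>v w = all_ones n" using Aw by (simp add: A_def B_def)
  have L: "L \<in> carrier_mat (p * n) (p * n)"
    using adjacency_mat_carrier[of "lex_product H G"] cardV unfolding L_def V_def by metis
  have "poly (char_poly L) x = det (- char_matrix L x)" by (rule char_poly_matrix[OF L])
  also have "\<dots> = det (mat (p * n) (p * n) (\<lambda>(a, b). (- char_matrix L x) $$ (f a, f b)))"
    using L f by (intro det_reindex[symmetric]) auto
  also have "mat (p * n) (p * n) (\<lambda>(a, b). (- char_matrix L x) $$ (f a, f b)) =
      block_mat p n (\<lambda>i j. mat n n (\<lambda>(k, l).
      (if i = j then B $$ (k, l) else 0) - K $$ (i, j) * (B *\<^sub>v w) $ k * all_ones n $ l))"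
  proof (rule eq_matI, goal_cases)
    case (1 a b)
    then have ab: "a < p * n" "b < p * n" by (simp_all add: block_mat_def)
    note less = div_mod_less_mult[OF ab(1)] div_mod_less_mult[OF ab(2)]
    have eq: "a = b \<longleftrightarrow> a div n = b div n \<and> a mod n = b mod n" by (metis div_mult_mod_eq)
    have "L $$ (f a, f b) = (if (e (f a), e (f b)) \<in> parcs (lex_product H G) then 1 else 0)"
      using ab by (simp add: L_def adjacency_mat_def e_def V_def[symmetric] cardV f_less)
    \<comment> \<open>Between different copies of \<open>G\<close> adjacency depends on the
      \<open>H\<close> coordinates alone, so the block is constant.\<close>
    also have "\<dots> = (if a div n = b div n then A $$ (a mod n, b mod n) else K $$ (a div n, b div n))"
      using ab less bij_betwE[OF eG]
      by (auto simp: ef g_def lex_product_def VH A_def adjacency_mat_def eG_def n_def[symmetric] K_def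
          pair_graph_loopfree[OF H])
    finally have "(- char_matrix L x) $$ (f a, f b) = (if a = b then x else 0) -
        (if a div n = b div n then A $$ (a mod n, b mod n) else K $$ (a div n, b div n))"
      using ab L by (simp add: char_matrix_def f_less f_eq)
    also have "\<dots> = (if a div n = b div n then B $$ (a mod n, b mod n) else 0) - K $$ (a div n, b div n)"
      using less A by (auto simp: eq B_def char_matrix_def K_def pair_graph_loopfree[OF H])
    finally show ?case
      using ab less by (simp add: block_mat_def Bw) (simp add: all_ones_def)
  qed (auto simp: block_mat_def)
  also have "det \<dots> = det B ^ p * det (1\<^sub>m p - (all_ones n \<bullet> w) \<cdot>\<^sub>m K)"
    by (rule det_block_rank_one[OF B K w all_ones_carrier])
  finally show ?thesis by (simp add: L_def A_def B_def char_poly_matrix[OF A, unfolded A_def] K_def)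
qed

text \<open>If \<open>(x I - C) w = e\<^sub>1\<close>, then \<open>W C = A W\<close> gives \<open>(x I - A) (W w) = W e\<^sub>1 = j\<close>, so both
  characteristic polynomials involve the same \<open>p \<times> p\<close> determinant.\<close>

lemma char_poly_lex_product:
  assumes H: "pair_graph H" and VH: "pverts H = {1..p}" and G: "pair_graph G"
  shows "char_poly (adjacency_mat (lex_product H G)) * main_char_poly G ^ p =
    char_poly (associated_mat p H G) * char_poly (adjacency_mat G) ^ p"
proof -
  define n where "n = card (pverts G)"
  define s where "s = num_main G"
  define A where "A = adjacency_mat G"
  define j where "j = all_ones n"
  define q where "q = main_char_poly G"
  define C where "C = frobenius_companion q"
  define W where "W = walk_mat G"
  have A: "A \<in> carrier_mat n n" and j: "j \<in> carrier_vec n" by (simp_all add: A_def n_def j_def)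
  have W: "W \<in> carrier_mat n s" and C: "C \<in> carrier_mat s s"
    by (simp_all add: W_def C_def q_def n_def s_def)
  have char_C: "char_poly C = q"
    using char_poly_frobenius_companion[OF finite_main_eigenvalues, of G]
    by (simp add: C_def q_def main_char_poly_def)
  let ?l = "char_poly (adjacency_mat (lex_product H G)) * q ^ p"
  let ?r = "char_poly (associated_mat p H G) * char_poly A ^ p"
  \<comment> \<open>Away from the roots of \<open>q\<close>, which is the characteristic polynomial
    of \<open>C\<close>, the matrix x I - C is invertible.\<close>
  have eq: "poly ?l x = poly ?r x" if x: "poly q x \<noteq> 0" for x
  proof -
    let ?B = "- char_matrix C x"
    have B: "?B \<in> carrier_mat s s" using C by simp
    have "det ?B \<noteq> 0" using x by (simp add: char_poly_matrix[OF C, symmetric] char_C)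
    then obtain B' where B': "B' \<in> carrier_mat s s" "?B * B' = 1\<^sub>m s"
      using det_non_zero_imp_unit[OF B, of "()"] by (auto simp: Units_def ring_mat_def)
    define w where "w = B' *\<^sub>v unit_vec s 0"
    have w: "w \<in> carrier_vec s" using B' by (simp add: w_def)
    have Bw: "?B *\<^sub>v w = unit_vec s 0"
      using assoc_mult_mat_vec[OF B B'(1) unit_vec_carrier, of 0] B'(2) by (simp add: w_def)
    have "- char_matrix A x * W = W * ?B"
    proof -
      have "- char_matrix A x = x \<cdot>\<^sub>m 1\<^sub>m n - A" "?B = x \<cdot>\<^sub>m 1\<^sub>m s - C"
        using A C by (auto intro!: eq_matI simp: char_matrix_def)
      moreover have "(x \<cdot>\<^sub>m 1\<^sub>m n - A) * W = x \<cdot>\<^sub>m W - A * W"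
        using A W by (simp add: minus_mult_distrib_mat[of _ n n] mult_smult_assoc_mat[of _ n n])
      moreover have "W * (x \<cdot>\<^sub>m 1\<^sub>m s - C) = x \<cdot>\<^sub>m W - W * C"
        
        using mult_minus_distrib_mat[OF W _ C, of "x \<cdot>\<^sub>m 1\<^sub>m s"] mult_smult_distrib[OF W one_carrier_mat, of x]
        by (simp add: right_mult_one_mat[OF W])
      ultimately show ?thesis
        using adjacency_mult_walk_mat[OF G] by (simp add: A_def W_def C_def q_def)
    qed
    moreover have "- char_matrix A x *\<^sub>v (W *\<^sub>v w) = (- char_matrix A x * W) *\<^sub>v w"
      using A W w by (intro assoc_mult_mat_vec[symmetric, of _ n n _ s]) auto
    moreover have "W * ?B *\<^sub>v w = W *\<^sub>v (?B *\<^sub>v w)"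
      using B W w by (intro assoc_mult_mat_vec) auto
    ultimately have Aw: "- char_matrix A x *\<^sub>v (W *\<^sub>v w) = j"
      using walk_mat_unit_vec[OF G] by (simp add: Bw W_def s_def j_def n_def)
    \<comment> \<open>This is the equality a = b of the overview: both characteristic polynomials
      get the same scalar in front of the adjacency matrix of \<open>H\<close>.\<close>
    have "j \<bullet> (W *\<^sub>v w) = (transpose_mat W *\<^sub>v j) \<bullet> w"
      by (rule transpose_vec_mult_scalar[OF W w j, symmetric])
    moreover have "W *\<^sub>v w \<in> carrier_vec n" using W w by simp
    ultimately show ?thesis
      using poly_char_poly_associated_mat[OF H w[unfolded s_def] Bw[unfolded C_def q_def s_def], of p]
        poly_char_poly_lex_product[OF H VH G, of "W *\<^sub>v w" x] Aw
      by (simp add: A_def n_def j_def W_def C_def[symmetric] q_def[symmetric] char_C)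
  qed
  \<comment> \<open>The factor \<open>q\<close> covers the excluded points, giving an identity at
    every complex number; the nonzero \<open>q\<close> is then cancelled as a polynomial.\<close>
  have "poly ((?l - ?r) * q) x = 0" for x using eq[of x] by (cases "poly q x = 0") auto
  then have "(?l - ?r) * q = 0" using poly_all_0_iff_0 by blast
  moreover have "q \<noteq> 0" using coeff_main_char_poly[of G] by (auto simp: q_def)
  ultimately show ?thesis by (simp add: q_def A_def)
qed

section \<open>Comparison of eigenvalue multiplicities\<close>

lemma count_sum_replicate_mset:
  assumes "finite S" "inj_on f S"
  shows "j \<in> S \<Longrightarrow> count (\<Sum>j\<in>S. replicate_mset (c j) (f j)) (f j) = c j"
    and "x \<notin> f ` S \<Longrightarrow> count (\<Sum>j\<in>S. replicate_mset (c j) (f j)) x = 0"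
proof -
  assume j: "j \<in> S"
  have "count (\<Sum>j\<in>S. replicate_mset (c j) (f j)) (f j) = (\<Sum>i\<in>S. if i = j then c i else 0)"
    unfolding count_sum using assms(2) j by (intro sum.cong) (auto simp: inj_on_def)
  with j assms(1) show "count (\<Sum>j\<in>S. replicate_mset (c j) (f j)) (f j) = c j" by simp
next
  assume "x \<notin> f ` S"
  then show "count (\<Sum>j\<in>S. replicate_mset (c j) (f j)) x = 0"
    unfolding count_sum by (intro sum.neutral) auto
qed

theorem theorem3p5:
  fixes H :: "nat pair_pre_digraph" and G :: "'a pair_pre_digraph"
    and p n s t :: nat and \<mu> :: "nat \<Rightarrow> complex" and m :: "nat \<Rightarrow> nat"
  assumes "pair_graph H" and "pverts H = {1..p}"
    and "pair_graph G" and "card (pverts G) = n"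
    and "s \<le> t" and "t \<le> n"
    and "inj_on \<mu> {1..t}"
    and "\<mu> ` {1..t} = {x. eigenvalue (adjacency_mat G) x}"
    and "\<mu> ` {1..s} = {x. main_eigenvalue G x}"
    and "\<And>j. j \<in> {1..t} \<Longrightarrow> m j = count (eigval_mset (adjacency_mat G)) (\<mu> j)"
  shows "eigval_mset (adjacency_mat (lex_product H G)) =
      (\<Sum>j\<in>{1..s}. replicate_mset (p * (m j - 1)) (\<mu> j))
    + (\<Sum>j\<in>{s+1..t}. replicate_mset (p * m j) (\<mu> j))
    + eigval_mset (associated_mat p H G)"
proof (rule multiset_eqI)
  fix x
  define A where "A = adjacency_mat G"
  let ?L = "adjacency_mat (lex_product H G)"
  let ?T = "associated_mat p H G"
  have nz: "char_poly B \<noteq> 0" if "B \<in> carrier_mat k k" for B :: "complex mat" and k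
    using degree_monic_char_poly[OF that] by auto
  have A: "A \<in> carrier_mat n n" using assms(4) by (auto simp: A_def)
  have A_nz: "char_poly A \<noteq> 0" and L_nz: "char_poly ?L \<noteq> 0"
    using nz[OF A] nz[OF adjacency_mat_carrier] by auto
  have T_nz: "char_poly ?T \<noteq> 0"
    by (rule nz[of _ "p * num_main G"]) (simp add: associated_mat_def Let_def)
  have m_nz: "main_char_poly G \<noteq> 0" using coeff_main_char_poly[of G] by auto
  \<comment> \<open>Taking roots turns the product identity into a multiset equation without
    subtraction; each main eigenvalue is a simple root of \<open>main_char_poly G\<close>.\<close>
  have "proots (char_poly ?L) + repeat_mset p (proots (main_char_poly G))
      = proots (char_poly ?T) + repeat_mset p (proots (char_poly A))"
    using arg_cong[OF char_poly_lex_product[OF assms(1-3)], of proots] A_nz L_nz T_nz m_nz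
    by (simp add: proots_mult proots_power A_def)
  moreover have "proots (main_char_poly G) = mset_set {x. main_eigenvalue G x}"
    unfolding main_char_poly_def by (subst proots_prod) (auto simp: sum_multiset_singleton)
  ultimately have "proots (char_poly ?L) + repeat_mset p (mset_set (\<mu> ` {1..s}))
      = proots (char_poly ?T) + repeat_mset p (proots (char_poly A))"
    using assms(9) by simp
  from arg_cong[OF this, of "\<lambda>X. count X x"]
  have key: "count (eigval_mset ?L) x + (if x \<in> \<mu> ` {1..s} then p else 0)
      = count (eigval_mset ?T) x + p * count (eigval_mset A) x"
    by (auto simp: eigval_mset_def count_mset_set' simp del: count_proots)
  have ev: "count (eigval_mset A) x > 0 \<longleftrightarrow> x \<in> \<mu> ` {1..t}"
    using A_nz eigenvalue_root_char_poly[OF A, of x] assms(8)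
    by (auto simp: eigval_mset_def A_def order_root)
  have inj: "inj_on \<mu> {1..s}" "inj_on \<mu> {s+1..t}"
    using assms(5) by (auto intro: inj_on_subset[OF assms(7)])
  note count1 = count_sum_replicate_mset[OF finite_atLeastAtMost inj(1)]
  note count2 = count_sum_replicate_mset[OF finite_atLeastAtMost inj(2)]
  have split: "{1..t} = {1..s} \<union> {s+1..t}" using assms(5) by auto
  have "\<mu> ` {1..s} \<inter> \<mu> ` {s+1..t} = \<mu> ` ({1..s} \<inter> {s+1..t})"
    using assms(5) by (intro inj_on_image_Int[OF assms(7), symmetric]) auto
  also have "\<dots> = {}" by auto
  finally have disj: "\<mu> ` {1..s} \<inter> \<mu> ` {s+1..t} = {}" .
  consider (main) j where "j \<in> {1..s}" "x = \<mu> j" | (nonmain) j where "j \<in> {s+1..t}" "x = \<mu> j"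
    | (none) "x \<notin> \<mu> ` {1..t}"
    unfolding split by blast
  then have "count (eigval_mset ?L) x =
      count (\<Sum>j\<in>{1..s}. replicate_mset (p * (m j - 1)) (\<mu> j)) x
    + count (\<Sum>j\<in>{s+1..t}. replicate_mset (p * m j) (\<mu> j)) x
    + count (eigval_mset ?T) x"
  proof cases
    case main
    then have x: "x \<in> \<mu> ` {1..s}" "x \<notin> \<mu> ` {s+1..t}" using disj by blast+
    have j: "j \<in> {1..t}" using main split by blast
    have mj: "count (eigval_mset A) x = m j" "m j > 0"
      using assms(10)[OF j] j main(2) ev by (auto simp: A_def)
    \<comment> \<open>As \<open>m j\<close> is positive, the subtraction in \<open>m j - 1\<close>
      is not truncated.\<close>
    then have "p * m j = p * (m j - 1) + p" by (cases "m j") auto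
    with key x mj show ?thesis
      using count1(1)[OF main(1)] count2(2)[OF x(2)] by (simp add: main(2))
  next
    case nonmain
    then have x: "x \<notin> \<mu> ` {1..s}" using disj by blast
    have j: "j \<in> {1..t}" using nonmain split by blast
    have "count (eigval_mset A) x = m j"
      using assms(10)[OF j] nonmain(2) by (simp add: A_def)
    with key x show ?thesis
      using count2(1)[OF nonmain(1)] count1(2)[OF x] by (simp add: nonmain(2))
  next
    case none
    then have x: "x \<notin> \<mu> ` {1..s}" "x \<notin> \<mu> ` {s+1..t}" unfolding split by auto
    have "count (eigval_mset A) x = 0" using none ev by blast
    with key x show ?thesis
      using count1(2)[OF x(1)] count2(2)[OF x(2)] by simp
  qed
  then show "count (eigval_mset ?L) x = count ((\<Sum>j\<in>{1..s}. replicate_mset (p * (m j - 1)) (\<mu> j))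
    + (\<Sum>j\<in>{s+1..t}. replicate_mset (p * m j) (\<mu> j)) + eigval_mset ?T) x" by simp
qed

end
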